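(* Let $n\in\mathbb{N}$. Let $I$ be the incidence matrix of the Tamari lattice $\mathrm{Tam}_n$ and let $C=-I\cdot(I^{-1})^t$ be the Coxeter matrix of $\mathrm{Tam}_n$. Then: 1. $C^{2n+2}=\mathrm{Id}$. 2. The entries of the matrix $C$ are $0$, $1$ and $-1$ (every entry belongs to $\{0,1,-1\}$). 3. The nonzero entries of any given column of $C$ all have the same sign.
   Context: $\mathrm{Tam}_n$ is the set of planar binary trees with $n$ inner vertices, ordered by the transitive closure of the cover relations: $T$ is covered by $S$ if $S$ is obtained from $T$ by replacing a subtree of the form $(A,(B,C))$ by $((A,B),C)$. The incidence matrix of a finite poset $P$ is the matrix with rows and columns indexed by $P$ whose entry $(x,y)$ is $1$ if $x\le y$ and $0$ otherwise. $(\cdot)^t$ denotes the transpose. *)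

theory Defs
  imports
    "HOL-Library.Tree"
    "Jordan_Normal_Form.Gauss_Jordan_Elimination"
begin

text \<open>Planar binary trees are trees without labels; \<^const>\<open>size\<close> counts inner vertices.\<close>

type_synonym pbtree = "unit tree"

abbreviation pair :: "pbtree \<Rightarrow> pbtree \<Rightarrow> pbtree" where
  "pair A B \<equiv> Node A () B"

definition Tam :: "nat \<Rightarrow> pbtree set" where
  "Tam n = {T. size T = n}"

text \<open>The rules \<open>left\<close> and \<open>right\<close> allow the rotated subtree to sit anywhere in the tree.\<close>

inductive tam_cover :: "pbtree \<Rightarrow> pbtree \<Rightarrow> bool" where
  rotate: "tam_cover (pair A (pair B C)) (pair (pair A B) C)"
| left: "tam_cover A A' \<Longrightarrow> tam_cover (pair A B) (pair A' B)"
| right: "tam_cover B B' \<Longrightarrow> tam_cover (pair A B) (pair A B')"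

definition tam_le :: "pbtree \<Rightarrow> pbtree \<Rightarrow> bool" where
  "tam_le = tam_cover\<^sup>*\<^sup>*"

text \<open>
  Matrices indexed by a finite poset are matrices in the library's sense once the elements are
  listed. The list \<open>xs\<close> is such a listing without repetitions, in any order: it need not be a
  linear extension. A change of the listing permutes rows and columns simultaneously.
\<close>

definition incidence_mat :: "('a \<Rightarrow> 'a \<Rightarrow> bool) \<Rightarrow> 'a list \<Rightarrow> rat mat" where
  "incidence_mat leq xs =
     mat (length xs) (length xs) (\<lambda>(i, j). if leq (xs ! i) (xs ! j) then 1 else 0)"

text \<open>
  The incidence matrix of a finite poset is invertible (unitriangular along a linear extension),
  so that \<^const>\<open>the\<close> is applied to a proper value for such matrices.
\<close>

definition coxeter_mat :: "('a \<Rightarrow> 'a \<Rightarrow> bool) \<Rightarrow> 'a list \<Rightarrow> rat mat" where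
  "coxeter_mat leq xs =
     - (incidence_mat leq xs * transpose_mat (the (mat_inverse (incidence_mat leq xs))))"

lemma finite_Tam: "finite (Tam n)"
proof (induction n rule: less_induct)
  case (less n)
  have "Tam n \<subseteq> insert Leaf (\<Union>k<n. \<Union>l<n. (\<lambda>(A, B). pair A B) ` (Tam k \<times> Tam l))"
  proof
    fix T assume "T \<in> Tam n"
    then show "T \<in> insert Leaf (\<Union>k<n. \<Union>l<n. (\<lambda>(A, B). pair A B) ` (Tam k \<times> Tam l))"
      by (cases T) (auto simp: Tam_def image_iff)
  qed
  moreover have "finite (insert Leaf (\<Union>k<n. \<Union>l<n. (\<lambda>(A, B). pair A B) ` (Tam k \<times> Tam l)))"
    using less by auto
  ultimately show ?case
    by (rule finite_subset)
qed

end

theory Submission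
  imports Defs "Jordan_Normal_Form.Determinant"
begin

text \<open>
  Put $n + 1$ distinct points $z_0, \ldots, z_n$ on a line and attach to a tree with $n$ inner
  vertices a rational function of them: the leaf gives $1$ and, if $A$ has $a$ inner vertices,
  $f_{(A,B)}(z_0, \ldots, z_n) = f_A(z_0, \ldots, z_a) f_B(z_{a+1}, \ldots, z_n) / (z_n - z_0)$.
  These functions (\<open>tree_fun\<close>) are linearly independent, so the Coxeter matrix may be studied on
  their span, where a cyclic symmetry appears that the trees do not show: one may rotate the points.

  Trees multiply as in the dendriform algebra of Loday and Ronco: the product of $S$ and $T$ is the
  sum of all trees that fall apart into $S$ and $T$ when they are cut along the path from the leaf
  number \<open>size S\<close> to the root. Up-sets and down-sets of the Tamari order are products of
  smaller up-sets and down-sets (\<open>tam_ge_pair\<close>, \<open>tam_le_pair_eq\<close>), and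
  $f$ turns products of trees into products of functions on adjacent runs of points
  (\<open>sum_tree_prod_tree_fun\<close>).

  The Coxeter transformation sends the sum of the up-set of $T$ to minus the sum of its
  down-set. A second family $h_T$ (\<open>coxeter_fun\<close>), again given by a recursion over the tree,
  describes it: products of trees become products of the functions $h$ that share the last point
  (\<open>sum_tree_prod_coxeter_fun\<close>). Both product rules come from one identity between
  $1/(y-x)$, $1/(z-y)$ and $1/(z-x)$. They give by induction over the tree
  \[ \sum_{S \ge T} h_S = \sum_{S \le T} f_S, \qquad
     \sum_{S \le T} h_S(z_1, \ldots, z_n, z_0) = (-1)^n \sum_{S \ge T} f_S(z_0, \ldots, z_n). \]
  The first identity says that the Coxeter transformation takes $f_T$ to $-h_T$. By the second one,
  its square is $(-1)^n$ times a rotation of the $n + 1$ points, so its power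
  $2n + 2$ has the sign $(-1)^{n(n+1)} = 1$ and is the identity.

  For the entries, the recursion of $h$ and of its rotation only multiplies functions on adjacent
  runs of points, up to a global sign. Hence $h_T$ is plus or minus the sum of $f$ over a set of
  trees (\<open>signed_set_sum_coxeter_fun\<close>), and the column of $T$ has the opposite sign on this set and is zero elsewhere.
\<close>

section \<open>Cutting and multiplying trees\<close>

text \<open>
  The leaves are numbered from the left, beginning with 0. The tree is cut along the path from
  leaf \<open>i\<close> to the root. The leaf is doubled, so both parts are trees again; the first \<open>i\<close> inner
  vertices go to the left part and the others to the right part.
\<close>

fun split_at :: "nat \<Rightarrow> pbtree \<Rightarrow> pbtree \<times> pbtree" where
  "split_at i Leaf = (Leaf, Leaf)"
| "split_at i (Node A u B) =
     (if i \<le> size A then (fst (split_at i A), pair (snd (split_at i A)) B)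
      else (pair A (fst (split_at (i - Suc (size A)) B)), snd (split_at (i - Suc (size A)) B)))"

text \<open>
  The root of a product comes from one of the two factors, which gives the two kinds of trees in the
  last equation: they are the summands of the two halves of the dendriform product.
\<close>

fun tree_prod :: "pbtree \<Rightarrow> pbtree \<Rightarrow> pbtree set" where
  "tree_prod Leaf T = {T}"
| "tree_prod (Node A u B) Leaf = {pair A B}"
| "tree_prod (Node A u B) (Node C v D) =
     pair A ` tree_prod B (pair C D) \<union> (\<lambda>X. pair X D) ` tree_prod (pair A B) C"

lemma size_tree_prod: "Z \<in> tree_prod S T \<Longrightarrow> size Z = size S + size T"
  by (induction S T arbitrary: Z rule: tree_prod.induct) auto

lemma finite_tree_prod [simp]: "finite (tree_prod S T)"
  by (induction S T rule: tree_prod.induct) auto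

lemma split_at_size [simp]: "split_at (size T) T = (T, Leaf)"
  by (induction T) auto

lemma split_at_0 [simp]: "split_at 0 T = (Leaf, T)"
  by (induction T) auto

text \<open>
  A tree determines the factors of any product in which it occurs, once the size of the left
  factor is known. This makes products of sets of trees disjoint unions.
\<close>

lemma split_at_tree_prod: "Z \<in> tree_prod S T \<Longrightarrow> split_at (size S) Z = (S, T)"
proof (induction S T arbitrary: Z rule: tree_prod.induct)
  case (3 A u B C v D)
  from 3(3) consider X where "X \<in> tree_prod B (pair C D)" "Z = pair A X"
    | X where "X \<in> tree_prod (pair A B) C" "Z = pair X D" by auto
  then show ?case
  proof cases
    case 1
    with "3.IH"(1) show ?thesis by simp
  next
    case 2
    with "3.IH"(2) size_tree_prod[OF 2(1)] show ?thesis by simp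
  qed
qed auto

lemma tree_prod_Leaf_right [simp]: "tree_prod S Leaf = {S}"
  by (cases S) auto

text \<open>Conversely, gluing the two parts of a cut back together recovers the tree among others.\<close>

lemma tree_prod_split_at: "i \<le> size Z \<Longrightarrow> Z \<in> tree_prod (fst (split_at i Z)) (snd (split_at i Z))"
proof (induction Z arbitrary: i)
  case Leaf
  then show ?case by simp
next
  case (Node A u B)
  show ?case
  proof (cases "i \<le> size A")
    case True
    with Node.IH(1)[of i] show ?thesis
      by (cases "fst (split_at i A)") auto
  next
    case False
    with Node.prems have "i - Suc (size A) \<le> size B" by simp
    from Node.IH(2)[OF this] False show ?thesis
      by (cases "snd (split_at (i - Suc (size A)) B)") auto
  qed
qed

section \<open>The Tamari order and cutting\<close>

lemma tam_le_refl [simp]: "tam_le T T"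
  by (simp add: tam_le_def)

lemma tam_le_trans: "tam_le R S \<Longrightarrow> tam_le S T \<Longrightarrow> tam_le R T"
  by (simp add: tam_le_def)

lemma tam_le_cover: "tam_cover S T \<Longrightarrow> tam_le S T"
  by (simp add: tam_le_def)

lemma tam_le_left: "tam_le A A' \<Longrightarrow> tam_le (pair A B) (pair A' B)"
  unfolding tam_le_def
  by (induction rule: rtranclp_induct) (auto intro: rtranclp.rtrancl_into_rtrancl tam_cover.left)

lemma tam_le_right: "tam_le B B' \<Longrightarrow> tam_le (pair A B) (pair A B')"
  unfolding tam_le_def
  by (induction rule: rtranclp_induct) (auto intro: rtranclp.rtrancl_into_rtrancl tam_cover.right)

lemma tam_le_pair: "tam_le A A' \<Longrightarrow> tam_le B B' \<Longrightarrow> tam_le (pair A B) (pair A' B')"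
  by (blast intro: tam_le_trans tam_le_left tam_le_right)

lemma tam_le_rotate: "tam_le (pair A (pair B C)) (pair (pair A B) C)"
  by (intro tam_le_cover tam_cover.rotate)

lemma tam_cover_size: "tam_cover S T \<Longrightarrow> size S = size T"
  by (induction rule: tam_cover.induct) auto

lemma tam_le_size: "tam_le S T \<Longrightarrow> size S = size T"
  unfolding tam_le_def by (induction rule: rtranclp_induct) (auto dest: tam_cover_size)

text \<open>
  A rotation increases the total size of the left subtrees. This weight therefore orders the trees
  compatibly with the Tamari order and replaces a linear extension.
\<close>

fun left_weight :: "pbtree \<Rightarrow> nat" where
  "left_weight Leaf = 0"
| "left_weight (Node A u B) = size A + left_weight A + left_weight B"

lemma tam_cover_left_weight: "tam_cover S T \<Longrightarrow> left_weight S < left_weight T"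
  by (induction rule: tam_cover.induct) (auto dest: tam_cover_size)

lemma tam_le_left_weight: "tam_le S T \<Longrightarrow> S = T \<or> left_weight S < left_weight T"
  unfolding tam_le_def by (induction rule: rtranclp_induct) (auto dest: tam_cover_left_weight)

text \<open>
  Cutting is monotone: a rotation whose two vertices lie on the same side of the cut survives as a
  rotation of that part, and a rotation whose edge is severed disappears.
\<close>

lemma tam_cover_split_at:
  "tam_cover S T \<Longrightarrow> tam_le (fst (split_at i S)) (fst (split_at i T)) \<and>
     tam_le (snd (split_at i S)) (snd (split_at i T))"
proof (induction arbitrary: i rule: tam_cover.induct)
  case (rotate A B C)
  show ?case by (auto intro: tam_le_rotate)
next
  case (left A A' B)
  from left.IH[of i] tam_cover_size[OF left.hyps] left.hyps show ?case
    by (auto intro: tam_le_left tam_le_cover)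
next
  case (right B B' A)
  from right.IH[of "i - Suc (size A)"] right.hyps show ?case
    by (auto intro: tam_le_right tam_le_cover)
qed

lemma tam_le_split_at:
  assumes "tam_le S T"
  shows "tam_le (fst (split_at i S)) (fst (split_at i T)) \<and>
     tam_le (snd (split_at i S)) (snd (split_at i T))"
  using assms[unfolded tam_le_def]
proof (induction rule: rtranclp_induct)
  case (step Y Z)
  with tam_cover_split_at[OF step.hyps(2), of i] show ?case
    by (blast intro: tam_le_trans)
qed simp

lemma tam_cover_LeafE: "tam_cover Leaf T \<Longrightarrow> P" "tam_cover T Leaf \<Longrightarrow> P"
  by (erule tam_cover.cases; simp)+

lemma tam_cover_pair_LeafD: "tam_cover (pair A Leaf) T \<Longrightarrow> \<exists>A'. T = pair A' Leaf \<and> tam_cover A A'"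
  by (erule tam_cover.cases) (auto elim: tam_cover_LeafE)

lemma tam_cover_Leaf_pairD: "tam_cover T (pair Leaf B) \<Longrightarrow> \<exists>B'. T = pair Leaf B' \<and> tam_cover B' B"
  by (erule tam_cover.cases) (auto elim: tam_cover_LeafE)

lemma tam_le_pair_LeafD:
  assumes "tam_le (pair A Leaf) T"
  shows "\<exists>A'. T = pair A' Leaf \<and> tam_le A A'"
  using assms[unfolded tam_le_def]
proof (induction rule: rtranclp_induct)
  case (step Y Z)
  then obtain A' where "Y = pair A' Leaf" "tam_le A A'" by blast
  with tam_cover_pair_LeafD[of A' Z] step.hyps(2) show ?case
    by (blast intro: tam_le_trans tam_le_cover)
qed simp

lemma tam_le_Leaf_pairD:
  assumes "tam_le T (pair Leaf B)"
  shows "\<exists>B'. T = pair Leaf B' \<and> tam_le B' B"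
  using assms[unfolded tam_le_def]
proof (induction rule: converse_rtranclp_induct)
  case (step Y Z)
  then obtain B' where "Z = pair Leaf B'" "tam_le B' B" by blast
  with tam_cover_Leaf_pairD[of Y B'] step.hyps(1) show ?case
    by (blast intro: tam_le_trans tam_le_cover)
qed simp

text \<open>
  The product of \<open>S\<close> and \<open>T\<close> has a smallest element, \<open>T\<close> grafted onto the
  last leaf of \<open>S\<close>, and a largest one, \<open>S\<close> grafted onto the first leaf of
  \<open>T\<close>.
\<close>

fun graft_right :: "pbtree \<Rightarrow> pbtree \<Rightarrow> pbtree" where
  "graft_right Leaf T = T"
| "graft_right (Node A u B) T = pair A (graft_right B T)"

fun graft_left :: "pbtree \<Rightarrow> pbtree \<Rightarrow> pbtree" where
  "graft_left S Leaf = S"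
| "graft_left S (Node A u B) = pair (graft_left S A) B"

lemma graft_right_pair_le: "tam_le (graft_right P (pair Q R)) (pair (graft_right P Q) R)"
proof (induction P)
  case (Node A u B)
  from tam_le_trans[OF tam_le_right[OF Node.IH(2)] tam_le_rotate] show ?case by simp
qed simp

lemma graft_left_pair_ge: "tam_le (pair P (graft_left Q R)) (graft_left (pair P Q) R)"
proof (induction R)
  case (Node A u B)
  from tam_le_trans[OF tam_le_rotate tam_le_left[OF Node.IH(1)]] show ?case by simp
qed simp

lemma graft_right_split_at_le:
  "tam_le (graft_right (fst (split_at i Z)) (snd (split_at i Z))) Z"
proof (induction Z arbitrary: i)
  case (Node A u B)
  show ?case
    using tam_le_trans[OF graft_right_pair_le tam_le_left[OF Node.IH(1)[of i]]]
      tam_le_right[OF Node.IH(2)[of "i - Suc (size A)"]] by simp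
qed simp

lemma graft_left_split_at_ge:
  "tam_le Z (graft_left (fst (split_at i Z)) (snd (split_at i Z)))"
proof (induction Z arbitrary: i)
  case (Node A u B)
  show ?case
    using tam_le_trans[OF tam_le_right[OF Node.IH(2)[of "i - Suc (size A)"]] graft_left_pair_ge]
      tam_le_left[OF Node.IH(1)[of i]] by simp
qed simp

section \<open>Up-sets and down-sets as products\<close>

definition set_prod :: "pbtree set \<Rightarrow> pbtree set \<Rightarrow> pbtree set" where
  "set_prod X Y = (\<Union>S\<in>X. \<Union>T\<in>Y. tree_prod S T)"

text \<open>
  The tree \<open>pair A B\<close> is \<open>B\<close> grafted onto the last leaf of \<open>pair A Leaf\<close>, hence the smallest
  element of the product of these two trees. Cutting is monotone, and all trees above
  \<open>pair A Leaf\<close> have an empty right subtree.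
\<close>

lemma tam_ge_pair:
  "{Z. tam_le (pair A B) Z} = set_prod ((\<lambda>S. pair S Leaf) ` {S. tam_le A S}) {T. tam_le B T}"
proof (intro equalityI subsetI)
  fix Z assume "Z \<in> {Z. tam_le (pair A B) Z}"
  then have Z: "tam_le (pair A B) Z" by simp
  from tam_le_split_at[OF this, of "Suc (size A)"]
  have "tam_le (pair A Leaf) (fst (split_at (Suc (size A)) Z))"
    and B: "tam_le B (snd (split_at (Suc (size A)) Z))" by auto
  then obtain S where S: "fst (split_at (Suc (size A)) Z) = pair S Leaf" "tam_le A S"
    using tam_le_pair_LeafD by blast
  have "Z \<in> tree_prod (pair S Leaf) (snd (split_at (Suc (size A)) Z))"
    using tree_prod_split_at[of "Suc (size A)" Z] S tam_le_size[OF Z] by simp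
  with S B show "Z \<in> set_prod ((\<lambda>S. pair S Leaf) ` {S. tam_le A S}) {T. tam_le B T}"
    unfolding set_prod_def by blast
next
  fix Z assume "Z \<in> set_prod ((\<lambda>S. pair S Leaf) ` {S. tam_le A S}) {T. tam_le B T}"
  then obtain S T where ST: "tam_le A S" "tam_le B T" "Z \<in> tree_prod (pair S Leaf) T"
    unfolding set_prod_def by blast
  from graft_right_split_at_le[of "size (pair S Leaf)" Z] ST(3)
  have "tam_le (pair S T) Z" by (simp only: split_at_tree_prod) simp
  with tam_le_pair[OF ST(1,2)] show "Z \<in> {Z. tam_le (pair A B) Z}"
    by (blast intro: tam_le_trans)
qed

text \<open>Dually, \<open>pair A B\<close> is the largest element of the product of \<open>A\<close> and \<open>pair Leaf B\<close>.\<close>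

lemma tam_le_pair_eq:
  "{Z. tam_le Z (pair A B)} = set_prod {S. tam_le S A} (pair Leaf ` {T. tam_le T B})"
proof (intro equalityI subsetI)
  fix Z assume "Z \<in> {Z. tam_le Z (pair A B)}"
  then have Z: "tam_le Z (pair A B)" by simp
  from tam_le_split_at[OF this, of "size A"]
  have "tam_le (snd (split_at (size A) Z)) (pair Leaf B)"
    and A: "tam_le (fst (split_at (size A) Z)) A" by auto
  then obtain T where T: "snd (split_at (size A) Z) = pair Leaf T" "tam_le T B"
    using tam_le_Leaf_pairD by blast
  have "Z \<in> tree_prod (fst (split_at (size A) Z)) (pair Leaf T)"
    using tree_prod_split_at[of "size A" Z] T tam_le_size[OF Z] by simp
  with T A show "Z \<in> set_prod {S. tam_le S A} (pair Leaf ` {T. tam_le T B})"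
    unfolding set_prod_def by blast
next
  fix Z assume "Z \<in> set_prod {S. tam_le S A} (pair Leaf ` {T. tam_le T B})"
  then obtain S T where ST: "tam_le S A" "tam_le T B" "Z \<in> tree_prod S (pair Leaf T)"
    unfolding set_prod_def by blast
  from graft_left_split_at_ge[of Z "size S"] ST(3)
  have "tam_le Z (pair S T)" by (simp only: split_at_tree_prod) simp
  with tam_le_pair[OF ST(1,2)] show "Z \<in> {Z. tam_le Z (pair A B)}"
    by (blast intro: tam_le_trans)
qed

lemma tam_ge_subset_Tam: "{S. tam_le T S} \<subseteq> Tam (size T)"
  by (auto simp: Tam_def dest: tam_le_size)

lemma tam_le_subset_Tam: "{S. tam_le S T} \<subseteq> Tam (size T)"
  by (auto simp: Tam_def dest: tam_le_size)

lemma set_prod_subset_Tam: "X \<subseteq> Tam m \<Longrightarrow> Y \<subseteq> Tam n \<Longrightarrow> set_prod X Y \<subseteq> Tam (m + n)"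
  by (auto simp: set_prod_def Tam_def dest!: size_tree_prod)

lemma sum_set_prod:
  assumes "X \<subseteq> Tam m" "Y \<subseteq> Tam n"
  shows "sum f (set_prod X Y) = (\<Sum>S\<in>X. \<Sum>T\<in>Y. sum f (tree_prod S T))"
proof -
  have fin: "finite X" "finite Y" using assms finite_Tam finite_subset by blast+
  have disj: "tree_prod S T \<inter> tree_prod S' T' = {}"
    if "S \<in> X" "S' \<in> X" "S \<noteq> S' \<or> T \<noteq> T'" for S S' T T'
  proof -
    have "size S = size S'" using that(1,2) assms(1) by (auto simp: Tam_def)
    with that(3) show ?thesis by (metis disjoint_iff prod.inject split_at_tree_prod)
  qed
  have "sum f (set_prod X Y) = (\<Sum>S\<in>X. sum f (\<Union>T\<in>Y. tree_prod S T))"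
    unfolding set_prod_def
  proof (rule sum.UNION_disjoint)
    show "\<forall>S\<in>X. \<forall>S'\<in>X. S \<noteq> S' \<longrightarrow> (\<Union>T\<in>Y. tree_prod S T) \<inter> (\<Union>T\<in>Y. tree_prod S' T) = {}"
      using disj by (simp add: Int_UN_distrib2)
  qed (use fin in auto)
  also have "\<dots> = (\<Sum>S\<in>X. \<Sum>T\<in>Y. sum f (tree_prod S T))"
    by (intro sum.cong refl sum.UNION_disjoint) (use fin disj in auto)
  finally show ?thesis .
qed

section \<open>Two families of rational functions\<close>

text \<open>
  The argument lists the points $z_0, \ldots, z_n$ with $n$ the size of the tree; the values on lists of
  another length have no meaning. The denominator is a product over the $n$ edges of a noncrossing
  tree that joins the points.
\<close>

fun tree_fun :: "pbtree \<Rightarrow> real list \<Rightarrow> real" where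
  "tree_fun Leaf zs = 1"
| "tree_fun (Node A u B) zs =
     tree_fun A (take (Suc (size A)) zs) * tree_fun B (drop (Suc (size A)) zs) / (last zs - hd zs)"

text \<open>
  Up to sign this is again a product over the edges of a noncrossing tree. With
  $z_a$ the point number \<open>size A\<close>, the left subtree uses the points up to
  $z_a$ and the right subtree the points from $z_a$ to the last but one, where $z_a$ has been moved
  to the end of the list. The remaining edge joins $z_a$ to the last point.
\<close>

fun coxeter_fun :: "pbtree \<Rightarrow> real list \<Rightarrow> real" where
  "coxeter_fun Leaf zs = 1"
| "coxeter_fun (Node A u B) zs =
     coxeter_fun A (take (Suc (size A)) zs) * coxeter_fun B (rotate1 (butlast (drop (size A) zs))) /
     (last zs - zs ! size A)"

lemma tree_fun_pair:
  assumes "length as = Suc (size A)" "bs \<noteq> []"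
  shows "tree_fun (pair A B) (as @ bs) = tree_fun A as * tree_fun B bs / (last bs - hd as)"
  using assms by (cases as) auto

lemma coxeter_fun_pair:
  assumes "length as = size A"
  shows "coxeter_fun (pair A B) (as @ a # bs @ [z]) = coxeter_fun A (as @ [a]) * coxeter_fun B (bs @ [a]) / (z - a)"
  using assms by (simp add: nth_append butlast_append)

declare tree_fun.simps(2) [simp del] coxeter_fun.simps(2) [simp del]

lemma sum_tree_prod_pair:
  "sum f (tree_prod (pair A B) (pair C D)) =
     (\<Sum>X\<in>tree_prod B (pair C D). f (pair A X)) + (\<Sum>X\<in>tree_prod (pair A B) C. f (pair X D))"
proof -
  have "pair A ` tree_prod B (pair C D) \<inter> (\<lambda>X. pair X D) ` tree_prod (pair A B) C = {}"
    by (auto dest: size_tree_prod)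
  then show ?thesis
    by (simp add: sum.union_disjoint sum.reindex inj_on_def)
qed

text \<open>
  Up to signs, the product of the reciprocals of two edges of the triangle $x, y, z$ is the sum of the
  other two such products. These are the only relations between the rational functions that the proof uses; the
  first is for \<open>tree_fun\<close>, where the two edges of the right hand side meet in the common
  point of the factors, and the second for \<open>coxeter_fun\<close>, where they meet in the last point.
\<close>

lemma triangle_relation:
  fixes x y z :: real
  assumes "x \<noteq> y" "x \<noteq> z" "y \<noteq> z"
  shows "1 / ((z - x) * (y - x)) + 1 / ((z - y) * (z - x)) = 1 / ((y - x) * (z - y))"
    and "1 / ((z - x) * (x - y)) + 1 / ((z - y) * (y - x)) = 1 / ((z - x) * (z - y))"
proof -
  have *: "1 / ((u + v) * u) + 1 / (v * (u + v)) = 1 / (u * v)"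
    if "u \<noteq> 0" "v \<noteq> 0" "u + v \<noteq> 0" for u v :: real
  proof -
    have "1 / ((u + v) * u) + 1 / (v * (u + v)) = (u + v) / ((u + v) * (u * v))"
      using that(1,2) by (simp only: add_divide_distrib) (simp add: ac_simps)
    with that(3) show ?thesis by simp
  qed
  from *[of "y - x" "z - y"] assms
  show 1: "1 / ((z - x) * (y - x)) + 1 / ((z - y) * (z - x)) = 1 / ((y - x) * (z - y))" by simp
  have "(z - x) * (x - y) = - ((z - x) * (y - x))" by (simp add: algebra_simps)
  then have "1 / ((z - x) * (x - y)) = - (1 / ((z - x) * (y - x)))" by simp
  with 1 show "1 / ((z - x) * (x - y)) + 1 / ((z - y) * (y - x)) = 1 / ((z - x) * (z - y))"
    by (simp add: mult.commute)
qed

lemma length_eq_appendE: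
  assumes "length xs = m + n"
  obtains ys zs where "xs = ys @ zs" "length ys = m" "length zs = n"
  using assms that[of "take m xs" "drop m xs"] by simp

lemma length_eq_append_ConsE:
  assumes "length xs = Suc (m + n)"
  obtains ys a zs where "xs = ys @ a # zs" "length ys = m" "length zs = n"
proof -
  from assms length_eq_appendE[of xs m "Suc n"] obtain ys zs
    where "xs = ys @ zs" "length ys = m" "length zs = Suc n" by auto
  with that show thesis by (cases zs) auto
qed

lemma length_eq_Cons_appendE:
  assumes "length xs = Suc (m + n)"
  obtains a ys zs where "xs = a # ys @ zs" "length ys = m" "length zs = n"
proof (cases xs)
  case (Cons a us)
  with assms have "length us = m + n" by simp
  then show thesis by (rule length_eq_appendE) (use Cons that in simp)
qed (use assms in simp)

lemma length_eq_append_snocE: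
  assumes "length xs = Suc (m + n)"
  obtains ys zs a where "xs = ys @ zs @ [a]" "length ys = m" "length zs = n"
proof (cases xs rule: rev_cases)
  case (snoc us a)
  with assms have "length us = m + n" by simp
  then show thesis by (rule length_eq_appendE) (use snoc that in simp)
qed (use assms in simp)

section \<open>The product rules\<close>

text \<open>
  The factors use adjacent runs of points with the point \<open>m\<close> in common. If neither
  is a leaf, the two kinds of trees in the product contribute the two summands of the first triangle
  relation for the first point, \<open>m\<close> and the last point.
\<close>

lemma sum_tree_prod_tree_fun:
  assumes "length as = size S" "length bs = size T" "distinct (as @ m # bs)"
  shows "(\<Sum>Z\<in>tree_prod S T. tree_fun Z (as @ m # bs)) = tree_fun S (as @ [m]) * tree_fun T (m # bs)"
  using assms
proof (induction S T arbitrary: as bs rule: tree_prod.induct)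
  case (1 T)
  then show ?case by simp
next
  case (2 A u B)
  then show ?case by simp
next
  case (3 A u B C v D)
  from "3.prems"(1) have "length as = Suc (size A + size B)" by simp
  then obtain x p q where as: "as = x # p @ q" "length p = size A" "length q = size B"
    by (rule length_eq_Cons_appendE)
  from "3.prems"(2) have "length bs = Suc (size C + size D)" by simp
  then obtain r s z where bs: "bs = r @ s @ [z]" "length r = size C" "length s = size D"
    by (rule length_eq_append_snocE)
  have d: "x \<noteq> m" "x \<noteq> z" "m \<noteq> z" using "3.prems"(3) by (auto simp: as bs)
  have "(\<Sum>X\<in>tree_prod B (pair C D). tree_fun (pair A X) (as @ m # bs)) =
      (\<Sum>X\<in>tree_prod B (pair C D). tree_fun X (q @ m # bs)) * (tree_fun A (x # p) / (z - x))"
    using tree_fun_pair[of "x # p" A "q @ m # bs"] as(2)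
    by (simp add: as(1) bs(1) sum_distrib_left sum_divide_distrib mult.commute)
  also have "\<dots> = tree_fun B (q @ [m]) * tree_fun (pair C D) (m # bs) * (tree_fun A (x # p) / (z - x))"
    using "3.IH"(1)[of q bs] "3.prems" as by simp
  also have "tree_fun (pair C D) (m # bs) = tree_fun C (m # r) * tree_fun D (s @ [z]) / (z - m)"
    using tree_fun_pair[of "m # r" C "s @ [z]" D] bs by simp
  finally have 1: "(\<Sum>X\<in>tree_prod B (pair C D). tree_fun (pair A X) (as @ m # bs)) =
      tree_fun A (x # p) * tree_fun B (q @ [m]) * tree_fun C (m # r) * tree_fun D (s @ [z]) *
      (1 / ((z - m) * (z - x)))"
    by (simp add: ac_simps)
  have "(\<Sum>X\<in>tree_prod (pair A B) C. tree_fun (pair X D) (as @ m # bs)) =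
      (\<Sum>X\<in>tree_prod (pair A B) C. tree_fun X (as @ m # r) * tree_fun D (s @ [z]) / (z - x))"
  proof (intro sum.cong refl)
    fix X assume "X \<in> tree_prod (pair A B) C"
    with size_tree_prod[OF this] show "tree_fun (pair X D) (as @ m # bs) =
        tree_fun X (as @ m # r) * tree_fun D (s @ [z]) / (z - x)"
      using tree_fun_pair[of "as @ m # r" X "s @ [z]" D] as bs by simp
  qed
  also have "\<dots> = tree_fun (pair A B) (as @ [m]) * tree_fun C (m # r) * (tree_fun D (s @ [z]) / (z - x))"
    using "3.IH"(2)[of as r] "3.prems" bs
    by (simp add: Int_Un_distrib flip: sum_distrib_right sum_divide_distrib)
  also have 3: "tree_fun (pair A B) (as @ [m]) = tree_fun A (x # p) * tree_fun B (q @ [m]) / (m - x)"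
    using tree_fun_pair[of "x # p" A "q @ [m]" B] as by simp
  finally have 2: "(\<Sum>X\<in>tree_prod (pair A B) C. tree_fun (pair X D) (as @ m # bs)) =
      tree_fun A (x # p) * tree_fun B (q @ [m]) * tree_fun C (m # r) * tree_fun D (s @ [z]) *
      (1 / ((z - x) * (m - x)))"
    by (simp add: ac_simps)
  have 4: "tree_fun (pair C D) (m # bs) = tree_fun C (m # r) * tree_fun D (s @ [z]) / (z - m)"
    using tree_fun_pair[of "m # r" C "s @ [z]" D] bs by simp
  have "(\<Sum>Z\<in>tree_prod (pair A B) (pair C D). tree_fun Z (as @ m # bs)) =
      tree_fun A (x # p) * tree_fun B (q @ [m]) * tree_fun C (m # r) * tree_fun D (s @ [z]) *
      (1 / ((z - x) * (m - x)) + 1 / ((z - m) * (z - x)))"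
    unfolding sum_tree_prod_pair 1 2 by (simp only: distrib_left add.commute)
  also have "\<dots> = tree_fun (pair A B) (as @ [m]) * tree_fun (pair C D) (m # bs)"
    unfolding triangle_relation(1)[OF d] 3 4 by simp
  finally show ?case by simp
qed

text \<open>
  Here the factors have the last point in common. The triangle consists of the last point
  \<open>z\<close> and of the points \<open>x\<close> and \<open>y\<close> that the recursion singles out for the two
  factors. When \<open>pair C D\<close> is multiplied into the right subtree \<open>B\<close>, its
  function is evaluated with \<open>x\<close> as the last point, which produces the edge from
  \<open>y\<close> to \<open>x\<close>.
\<close>

lemma sum_tree_prod_coxeter_fun:
  assumes "length as = size S" "length bs = size T" "distinct (as @ bs @ [z])"
  shows "(\<Sum>Z\<in>tree_prod S T. coxeter_fun Z (as @ bs @ [z])) = coxeter_fun S (as @ [z]) * coxeter_fun T (bs @ [z])"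
  using assms
proof (induction S T arbitrary: as bs z rule: tree_prod.induct)
  case (1 T)
  then show ?case by simp
next
  case (2 A u B)
  then show ?case by simp
next
  case (3 A u B C v D)
  from "3.prems"(1) have "length as = Suc (size A + size B)" by simp
  then obtain p x q where as: "as = p @ x # q" "length p = size A" "length q = size B"
    by (rule length_eq_append_ConsE)
  from "3.prems"(2) have "length bs = Suc (size C + size D)" by simp
  then obtain r y s where bs: "bs = r @ y # s" "length r = size C" "length s = size D"
    by (rule length_eq_append_ConsE)
  have d: "x \<noteq> y" "x \<noteq> z" "y \<noteq> z" using "3.prems"(3) by (auto simp: as bs)
  have "(\<Sum>X\<in>tree_prod B (pair C D). coxeter_fun (pair A X) (as @ bs @ [z])) =
      (\<Sum>X\<in>tree_prod B (pair C D). coxeter_fun X (q @ bs @ [x])) * (coxeter_fun A (p @ [x]) / (z - x))"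
    using coxeter_fun_pair[of p A _ x "q @ bs" z] as(2)
    by (simp add: as(1) sum_distrib_left sum_divide_distrib mult.commute)
  also have "\<dots> = coxeter_fun B (q @ [x]) * coxeter_fun (pair C D) (bs @ [x]) * (coxeter_fun A (p @ [x]) / (z - x))"
    using "3.IH"(1)[of q bs x] "3.prems" as by simp
  also have "coxeter_fun (pair C D) (bs @ [x]) = coxeter_fun C (r @ [y]) * coxeter_fun D (s @ [y]) / (x - y)"
    using coxeter_fun_pair[of r C D y s x] bs by simp
  finally have 1: "(\<Sum>X\<in>tree_prod B (pair C D). coxeter_fun (pair A X) (as @ bs @ [z])) =
      coxeter_fun A (p @ [x]) * coxeter_fun B (q @ [x]) * coxeter_fun C (r @ [y]) * coxeter_fun D (s @ [y]) *
      (1 / ((z - x) * (x - y)))"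
    by (simp add: ac_simps)
  have "(\<Sum>X\<in>tree_prod (pair A B) C. coxeter_fun (pair X D) (as @ bs @ [z])) =
      (\<Sum>X\<in>tree_prod (pair A B) C. coxeter_fun X (as @ r @ [y]) * coxeter_fun D (s @ [y]) / (z - y))"
  proof (intro sum.cong refl)
    fix X assume "X \<in> tree_prod (pair A B) C"
    with size_tree_prod[OF this] show "coxeter_fun (pair X D) (as @ bs @ [z]) =
        coxeter_fun X (as @ r @ [y]) * coxeter_fun D (s @ [y]) / (z - y)"
      using coxeter_fun_pair[of "as @ r" X D y s z] as bs by simp
  qed
  also have "\<dots> = coxeter_fun (pair A B) (as @ [y]) * coxeter_fun C (r @ [y]) * (coxeter_fun D (s @ [y]) / (z - y))"
    using "3.IH"(2)[of as r y] "3.prems" bs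
    by (simp add: Int_Un_distrib flip: sum_distrib_right sum_divide_distrib)
  also have "coxeter_fun (pair A B) (as @ [y]) = coxeter_fun A (p @ [x]) * coxeter_fun B (q @ [x]) / (y - x)"
    using coxeter_fun_pair[of p A B x q y] as by simp
  finally have 2: "(\<Sum>X\<in>tree_prod (pair A B) C. coxeter_fun (pair X D) (as @ bs @ [z])) =
      coxeter_fun A (p @ [x]) * coxeter_fun B (q @ [x]) * coxeter_fun C (r @ [y]) * coxeter_fun D (s @ [y]) *
      (1 / ((z - y) * (y - x)))"
    by (simp add: ac_simps)
  have 3: "coxeter_fun (pair A B) (as @ [z]) = coxeter_fun A (p @ [x]) * coxeter_fun B (q @ [x]) / (z - x)"
    using coxeter_fun_pair[of p A B x q z] as by simp
  have 4: "coxeter_fun (pair C D) (bs @ [z]) = coxeter_fun C (r @ [y]) * coxeter_fun D (s @ [y]) / (z - y)"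
    using coxeter_fun_pair[of r C D y s z] bs by simp
  have "(\<Sum>Z\<in>tree_prod (pair A B) (pair C D). coxeter_fun Z (as @ bs @ [z])) =
      coxeter_fun A (p @ [x]) * coxeter_fun B (q @ [x]) * coxeter_fun C (r @ [y]) * coxeter_fun D (s @ [y]) *
      (1 / ((z - x) * (x - y)) + 1 / ((z - y) * (y - x)))"
    unfolding sum_tree_prod_pair 1 2 by (simp only: distrib_left)
  also have "\<dots> = coxeter_fun (pair A B) (as @ [z]) * coxeter_fun (pair C D) (bs @ [z])"
    unfolding triangle_relation(2)[OF d] 3 4 by simp
  finally show ?case by simp
qed

lemma sum_set_prod_tree_fun:
  assumes "X \<subseteq> Tam (length as)" "Y \<subseteq> Tam (length bs)" "distinct (as @ m # bs)"
  shows "(\<Sum>Z\<in>set_prod X Y. tree_fun Z (as @ m # bs)) =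
    (\<Sum>S\<in>X. tree_fun S (as @ [m])) * (\<Sum>T\<in>Y. tree_fun T (m # bs))"
proof -
  have "(\<Sum>Z\<in>set_prod X Y. tree_fun Z (as @ m # bs)) =
      (\<Sum>S\<in>X. \<Sum>T\<in>Y. tree_fun S (as @ [m]) * tree_fun T (m # bs))"
    unfolding sum_set_prod[OF assms(1,2)]
    by (intro sum.cong refl sum_tree_prod_tree_fun) (use assms in \<open>auto simp: Tam_def\<close>)
  then show ?thesis by (simp add: sum_product)
qed

lemma sum_set_prod_coxeter_fun:
  assumes "X \<subseteq> Tam (length as)" "Y \<subseteq> Tam (length bs)" "distinct (as @ bs @ [z])"
  shows "(\<Sum>Z\<in>set_prod X Y. coxeter_fun Z (as @ bs @ [z])) =
    (\<Sum>S\<in>X. coxeter_fun S (as @ [z])) * (\<Sum>T\<in>Y. coxeter_fun T (bs @ [z]))"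
proof -
  have "(\<Sum>Z\<in>set_prod X Y. coxeter_fun Z (as @ bs @ [z])) =
      (\<Sum>S\<in>X. \<Sum>T\<in>Y. coxeter_fun S (as @ [z]) * coxeter_fun T (bs @ [z]))"
    unfolding sum_set_prod[OF assms(1,2)]
    by (intro sum.cong refl sum_tree_prod_coxeter_fun) (use assms in \<open>auto simp: Tam_def\<close>)
  then show ?thesis by (simp add: sum_product)
qed

lemma pair_Leaf_image_Tam:
  "X \<subseteq> Tam m \<Longrightarrow> (\<lambda>S. pair S Leaf) ` X \<subseteq> Tam (Suc m)"
  "X \<subseteq> Tam m \<Longrightarrow> pair Leaf ` X \<subseteq> Tam (Suc m)"
  by (auto simp: Tam_def)

lemma sum_image_pair_Leaf:
  "(\<Sum>Z\<in>(\<lambda>S. pair S Leaf) ` X. f Z) = (\<Sum>S\<in>X. f (pair S Leaf))"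
  "(\<Sum>Z\<in>pair Leaf ` X. f Z) = (\<Sum>S\<in>X. f (pair Leaf S))"
  by (simp_all add: sum.reindex inj_on_def)

lemma sum_tree_fun_pair_Leaf:
  assumes "X \<subseteq> Tam m" "length as = Suc m"
  shows "(\<Sum>Z\<in>(\<lambda>S. pair S Leaf) ` X. tree_fun Z (as @ [z])) = (\<Sum>S\<in>X. tree_fun S as) / (z - hd as)"
    and "(\<Sum>Z\<in>pair Leaf ` X. tree_fun Z (z # as)) = (\<Sum>S\<in>X. tree_fun S as) / (last as - z)"
proof -
  have "tree_fun (pair S Leaf) (as @ [z]) = tree_fun S as / (z - hd as)" if "S \<in> X" for S
    using tree_fun_pair[of as S "[z]" Leaf] that assms by (auto simp: Tam_def)
  then show "(\<Sum>Z\<in>(\<lambda>S. pair S Leaf) ` X. tree_fun Z (as @ [z])) = (\<Sum>S\<in>X. tree_fun S as) / (z - hd as)"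
    by (simp add: sum_image_pair_Leaf sum_divide_distrib)
  have "tree_fun (pair Leaf S) (z # as) = tree_fun S as / (last as - z)" for S
    using tree_fun_pair[of "[z]" Leaf as S] assms(2) by (cases as) auto
  then show "(\<Sum>Z\<in>pair Leaf ` X. tree_fun Z (z # as)) = (\<Sum>S\<in>X. tree_fun S as) / (last as - z)"
    by (simp add: sum_image_pair_Leaf sum_divide_distrib)
qed

section \<open>Sums over up-sets and down-sets\<close>

lemma sum_tree_fun_above_pair:
  assumes "length as = Suc (size A)" "length bs = size B" "distinct (as @ b # bs)"
  shows "(\<Sum>S | tam_le (pair A B) S. tree_fun S (as @ b # bs)) =
    (\<Sum>S | tam_le A S. tree_fun S as) * (\<Sum>S | tam_le B S. tree_fun S (b # bs)) / (b - hd as)"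
  unfolding tam_ge_pair
  using sum_set_prod_tree_fun[OF _ _ assms(3)] pair_Leaf_image_Tam(1)[OF tam_ge_subset_Tam[of A]]
    tam_ge_subset_Tam[of B] sum_tree_fun_pair_Leaf(1)[OF tam_ge_subset_Tam, of as A b] assms
  by simp

lemma sum_tree_fun_below_pair:
  assumes "length as = size A" "length bs = Suc (size B)" "distinct (as @ a # bs)"
  shows "(\<Sum>S | tam_le S (pair A B). tree_fun S (as @ a # bs)) =
    (\<Sum>S | tam_le S A. tree_fun S (as @ [a])) * (\<Sum>S | tam_le S B. tree_fun S bs) / (last bs - a)"
  unfolding tam_le_pair_eq
  using sum_set_prod_tree_fun[OF _ _ assms(3)] pair_Leaf_image_Tam(2)[OF tam_le_subset_Tam[of B]]
    tam_le_subset_Tam[of A] sum_tree_fun_pair_Leaf(2)[OF tam_le_subset_Tam, of bs B a] assms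
  by simp

lemma tam_le_Leaf_iff [simp]: "tam_le Leaf T \<longleftrightarrow> T = Leaf" "tam_le T Leaf \<longleftrightarrow> T = Leaf"
  by (auto dest: tam_le_size)

text \<open>
  Both sides satisfy the same recursion: the up-set of \<open>pair A B\<close> is the product of the up-sets of
  \<open>pair A Leaf\<close> and \<open>B\<close>, whose functions share the last point, and this agrees with the
  formula for the down-set, where the functions of \<open>A\<close> and of \<open>pair Leaf B\<close> share the point
  number \<open>size A\<close>.
\<close>

lemma sum_coxeter_fun_above:
  assumes "length zs = Suc (size T)" "distinct zs"
  shows "(\<Sum>S | tam_le T S. coxeter_fun S zs) = (\<Sum>S | tam_le S T. tree_fun S zs)"
  using assms
proof (induction T arbitrary: zs)
  case Leaf
  then show ?case by simp
next
  case (Node A u B)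
  from Node.prems(1) obtain us z where "zs = us @ [z]" "length us = Suc (size A + size B)"
    by (cases zs rule: rev_cases) auto
  moreover from this(2) obtain as a bs
    where "us = as @ a # bs" and len: "length as = size A" "length bs = size B"
    by (rule length_eq_append_ConsE)
  ultimately have zs: "zs = as @ a # bs @ [z]" by simp
  have "coxeter_fun (pair S Leaf) (as @ [a, z]) = coxeter_fun S (as @ [a]) / (z - a)" if "tam_le A S" for S
    using coxeter_fun_pair[of as S Leaf a "[]" z] tam_le_size[OF that] len by simp
  then have *: "(\<Sum>S\<in>(\<lambda>S. pair S Leaf) ` {S. tam_le A S}. coxeter_fun S (as @ [a, z])) =
      (\<Sum>S | tam_le A S. coxeter_fun S (as @ [a])) / (z - a)"
    by (simp add: sum_image_pair_Leaf sum_divide_distrib)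
  have "(\<Sum>S | tam_le (pair A B) S. coxeter_fun S zs) =
      (\<Sum>S | tam_le A S. coxeter_fun S (as @ [a])) / (z - a) * (\<Sum>S | tam_le B S. coxeter_fun S (bs @ [z]))"
    unfolding tam_ge_pair
    using sum_set_prod_coxeter_fun[of _ "as @ [a]" _ bs z] Node.prems len * tam_ge_subset_Tam[of B]
      pair_Leaf_image_Tam(1)[OF tam_ge_subset_Tam[of A]]
    by (simp add: zs)
  also have "\<dots> = (\<Sum>S | tam_le S A. tree_fun S (as @ [a])) * (\<Sum>S | tam_le S B. tree_fun S (bs @ [z])) / (z - a)"
    using Node.IH Node.prems len by (simp add: zs)
  also have "\<dots> = (\<Sum>S | tam_le S (pair A B). tree_fun S zs)"
    using sum_tree_fun_below_pair[of as A "bs @ [z]" B a] Node.prems len by (simp add: zs)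
  finally show ?case by simp
qed

text \<open>
  The rotation makes the first point \<open>z\<close> the last one, where the functions of \<open>A\<close> and of
  \<open>pair Leaf B\<close> meet. The edge that the root of \<open>pair Leaf B\<close> adds runs from \<open>b\<close> to
  \<open>z\<close>, whereas the recursion for up-sets has the edge from \<open>z\<close> to \<open>b\<close>. Hence each inner vertex
  contributes a sign.
\<close>

lemma sum_coxeter_fun_below_rotate1:
  assumes "length zs = Suc (size T)" "distinct zs"
  shows "(\<Sum>S | tam_le S T. coxeter_fun S (rotate1 zs)) = (-1) ^ size T * (\<Sum>S | tam_le T S. tree_fun S zs)"
  using assms
proof (induction T arbitrary: zs)
  case Leaf
  then show ?case by simp
next
  case (Node A u B)
  from Node.prems(1) obtain z us where "zs = z # us" "length us = Suc (size A + size B)"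
    by (auto simp: length_Suc_conv)
  moreover from this(2) obtain as b bs
    where "us = as @ b # bs" and len: "length as = size A" "length bs = size B"
    by (rule length_eq_append_ConsE)
  ultimately have zs: "zs = z # as @ b # bs" by simp
  have "coxeter_fun (pair Leaf S) (b # bs @ [z]) = coxeter_fun S (bs @ [b]) / (z - b)" for S
    using coxeter_fun_pair[of "[]" Leaf S b bs z] by simp
  then have *: "(\<Sum>S\<in>pair Leaf ` {S. tam_le S B}. coxeter_fun S (b # bs @ [z])) =
      (\<Sum>S | tam_le S B. coxeter_fun S (bs @ [b])) / (z - b)"
    by (simp add: sum_image_pair_Leaf sum_divide_distrib)
  have "(\<Sum>S | tam_le S (pair A B). coxeter_fun S (rotate1 zs)) =
      (\<Sum>S | tam_le S A. coxeter_fun S (as @ [z])) * ((\<Sum>S | tam_le S B. coxeter_fun S (bs @ [b])) / (z - b))"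
    unfolding tam_le_pair_eq
    using sum_set_prod_coxeter_fun[of _ as _ "b # bs" z] Node.prems len * tam_le_subset_Tam[of A]
      pair_Leaf_image_Tam(2)[OF tam_le_subset_Tam[of B]]
    by (simp add: zs)
  also have "\<dots> = (-1) ^ (size A + size B) * ((\<Sum>S | tam_le A S. tree_fun S (z # as)) *
      (\<Sum>S | tam_le B S. tree_fun S (b # bs)) / (z - b))"
    using Node.IH(1)[of "z # as"] Node.IH(2)[of "b # bs"] Node.prems len
    by (simp add: zs power_add)
  also have "\<dots> = (-1) ^ size (pair A B) * (\<Sum>S | tam_le (pair A B) S. tree_fun S zs)"
    using sum_tree_fun_above_pair[of "z # as" A bs B b] Node.prems len
    by (simp add: zs minus_divide_right)
  finally show ?case by simp
qed

section \<open>Linear independence\<close>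

lemma tree_fun_translate: "length zs = Suc (size T) \<Longrightarrow> tree_fun T (map ((+) t) zs) = tree_fun T zs"
proof (induction T arbitrary: zs)
  case (Node A u B)
  from Node.prems have "zs \<noteq> []" by auto
  with Node show ?case
    by (simp add: tree_fun.simps(2) take_map drop_map last_map hd_map)
qed simp

text \<open>
  If the points form two nonempty clusters that move apart, the edge of the root becomes infinitely long,
  while the other factors stay bounded.
\<close>

lemma tendsto_tree_fun_0:
  assumes "length xs + length ys = Suc (size T)" "xs \<noteq> []" "ys \<noteq> []"
  shows "((\<lambda>t. tree_fun T (xs @ map ((+) t) ys)) \<longlongrightarrow> 0) at_top"
  using assms
proof (induction T arbitrary: xs ys)
  case Leaf
  then show ?case by (cases xs; cases ys) auto
next
  case (Node A u B)
  have conv: "\<exists>L. ((\<lambda>t. tree_fun S (us @ map ((+) t) vs)) \<longlongrightarrow> L) at_top"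
    if "S = A \<or> S = B" "length us + length vs = Suc (size S)" for S us vs
  proof (cases "us = [] \<or> vs = []")
    case True
    have "\<exists>L. \<forall>t. tree_fun S (us @ map ((+) t) vs) = L"
      using that True tree_fun_translate[of vs S] by auto
    then show ?thesis using tendsto_const by force
  next
    case False
    with that Node.IH(1)[of us vs] Node.IH(2)[of us vs] show ?thesis by blast
  qed
  let ?m = "Suc (size A)"
  have lenA: "length (take ?m xs) + length (take (?m - length xs) ys) = Suc (size A)"
    and lenB: "length (drop ?m xs) + length (drop (?m - length xs) ys) = Suc (size B)"
    using Node.prems(1) by auto
  obtain L where L: "((\<lambda>t. tree_fun A (take ?m xs @ map ((+) t) (take (?m - length xs) ys))) \<longlongrightarrow> L) at_top"
    using conv[OF _ lenA] by blast
  obtain M where M: "((\<lambda>t. tree_fun B (drop ?m xs @ map ((+) t) (drop (?m - length xs) ys))) \<longlongrightarrow> M) at_top"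
    using conv[OF _ lenB] by blast
  have "filterlim (\<lambda>t. (last ys - hd xs) + t) at_top at_top"
    by (intro filterlim_tendsto_add_at_top[OF tendsto_const] filterlim_ident)
  then have "((\<lambda>t. inverse ((last ys - hd xs) + t)) \<longlongrightarrow> 0) at_top"
    by (rule tendsto_inverse_0_at_top)
  from tendsto_mult[OF tendsto_mult[OF L M] this] Node.prems(2,3) show ?case
    by (simp add: tree_fun.simps(2) take_map drop_map last_map divide_inverse algebra_simps)
qed

lemma eventually_distinct_translate:
  fixes xs ys :: "real list"
  assumes "distinct xs" "distinct ys"
  shows "eventually (\<lambda>t. distinct (xs @ map ((+) t) ys)) at_top"
proof -
  have "eventually (\<lambda>t. \<forall>x\<in>set xs. \<forall>y\<in>set ys. x \<noteq> t + y) at_top"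
  proof (intro eventually_ball_finite ballI finite_set)
    fix x y :: real
    show "eventually (\<lambda>t. x \<noteq> t + y) at_top"
      using eventually_gt_at_top[of "x - y"] by eventually_elim auto
  qed
  then show ?thesis
    by eventually_elim (use assms in \<open>auto simp: distinct_map inj_on_def\<close>)
qed

text \<open>
  The position of the root separates the functions. After multiplication with the length of the root edge,
  common to all trees, let the clusters \<open>xs\<close> and \<open>ys\<close> move apart: the trees whose root does not sit
  exactly in the gap retain an edge across it and vanish in the limit.
\<close>

lemma tree_fun_independent_gap:
  assumes zero: "\<And>zs. distinct zs \<Longrightarrow> length zs = Suc n \<Longrightarrow> (\<Sum>T\<in>Tam n. c T * tree_fun T zs) = 0"
    and len: "length xs + length ys = Suc n" and ne: "xs \<noteq> []" "ys \<noteq> []"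
    and dist: "distinct xs" "distinct ys"
  shows "(\<Sum>A\<in>Tam (length xs - 1). \<Sum>B\<in>Tam (length ys - 1). c (pair A B) * tree_fun A xs * tree_fun B ys) = 0"
proof -
  have pos: "0 < length xs" "0 < length ys" using ne by simp_all
  have n: "Suc (length xs - Suc 0 + (length ys - Suc 0)) = n" using len pos by linarith
  \<comment> \<open>the trees whose root sits in the gap, \<open>g\<close> the rescaled functions and \<open>L\<close> their limits\<close>
  define root_at where "root_at = (\<lambda>(A, B). pair A B) ` (Tam (length xs - 1) \<times> Tam (length ys - 1))"
  define g where "g T t = tree_fun T (xs @ map ((+) t) ys) * (t + last ys - hd xs)" for T t
  define L where "L T = (if T \<in> root_at then tree_fun (left T) xs * tree_fun (right T) ys else 0)" for T
  have lim: "((g T) \<longlongrightarrow> L T) at_top" if "T \<in> Tam n" for T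
  proof (cases T)
    case Leaf
    with that len ne show ?thesis by (cases xs; cases ys) (simp_all add: Tam_def)
  next
    case (Node A u B)
    let ?m = "Suc (size A)"
    have sz: "size A + size B + 1 = n" using that Node by (simp add: Tam_def)
    have "eventually (\<lambda>t. t + last ys - hd xs \<noteq> 0) at_top"
      using eventually_gt_at_top[of "hd xs - last ys"] by eventually_elim auto
    then have g: "eventually (\<lambda>t. g T t = tree_fun A (take ?m xs @ map ((+) t) (take (?m - length xs) ys)) *
        tree_fun B (drop ?m xs @ map ((+) t) (drop (?m - length xs) ys))) at_top"
    proof eventually_elim
      case (elim t)
      with ne show ?case
        by (simp add: g_def Node tree_fun.simps(2) take_map drop_map last_map)
    qed
    have "((\<lambda>t. tree_fun A (take ?m xs @ map ((+) t) (take (?m - length xs) ys)) *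
        tree_fun B (drop ?m xs @ map ((+) t) (drop (?m - length xs) ys))) \<longlongrightarrow> L T) at_top"
    proof (cases "?m" "length xs" rule: linorder_cases)
      case less
      then have "L T = 0" using Node sz pos by (auto simp: L_def root_at_def Tam_def)
      with tendsto_mult_left[OF tendsto_tree_fun_0[of "drop ?m xs" ys B], of "tree_fun A (take ?m xs)"]
      show ?thesis using less len sz ne by simp
    next
      case equal
      then have "T \<in> root_at" using Node sz len pos by (auto simp: root_at_def Tam_def)
      with equal Node show ?thesis using tree_fun_translate[of ys B] sz len by (simp add: L_def)
    next
      case greater
      then have "L T = 0" using Node sz pos by (auto simp: L_def root_at_def Tam_def)
      with tendsto_mult_right[OF tendsto_tree_fun_0[of xs "take (?m - length xs) ys" A],
          of "tree_fun B (drop (?m - length xs) ys)"]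
      show ?thesis using greater len sz ne tree_fun_translate[of "drop (?m - length xs) ys" B] by simp
    qed
    then show ?thesis using g by (simp add: tendsto_cong)
  qed
  have "((\<lambda>t. \<Sum>T\<in>Tam n. c T * g T t) \<longlongrightarrow> (\<Sum>T\<in>Tam n. c T * L T)) at_top"
    by (intro tendsto_sum tendsto_mult tendsto_const lim)
  moreover have "eventually (\<lambda>t. (\<Sum>T\<in>Tam n. c T * g T t) = 0) at_top"
    using eventually_distinct_translate[OF dist]
  proof eventually_elim
    case (elim t)
    from zero[OF elim] len show ?case
      by (simp add: g_def flip: mult.assoc sum_distrib_right)
  qed
  then have "((\<lambda>t. \<Sum>T\<in>Tam n. c T * g T t) \<longlongrightarrow> 0) at_top"
    by (rule tendsto_eventually)
  ultimately have "(\<Sum>T\<in>Tam n. c T * L T) = 0"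
    by (rule tendsto_unique[rotated]) simp
  also have "(\<Sum>T\<in>Tam n. c T * L T) = (\<Sum>T\<in>root_at. c T * L T)"
  proof (rule sum.mono_neutral_right)
    show "root_at \<subseteq> Tam n" by (auto simp: root_at_def Tam_def n)
  qed (auto simp: finite_Tam L_def)
  also have "\<dots> = (\<Sum>(A, B)\<in>Tam (length xs - 1) \<times> Tam (length ys - 1). c (pair A B) * tree_fun A xs * tree_fun B ys)"
  proof -
    have "(\<Sum>T\<in>root_at. c T * L T) =
        (\<Sum>p\<in>Tam (length xs - 1) \<times> Tam (length ys - 1). c (case p of (A, B) \<Rightarrow> pair A B) * L (case p of (A, B) \<Rightarrow> pair A B))"
      unfolding root_at_def by (rule sum.reindex[unfolded o_def]) (auto simp: inj_on_def)
    also have "\<dots> = (\<Sum>(A, B)\<in>Tam (length xs - 1) \<times> Tam (length ys - 1). c (pair A B) * tree_fun A xs * tree_fun B ys)"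
      by (rule sum.cong) (auto simp: L_def root_at_def)
    finally show ?thesis .
  qed
  finally show ?thesis by (simp add: sum.cartesian_product)
qed

text \<open>
  The limit leaves products of functions in independent sets of points, so that the induction
  hypothesis applies first for fixed \<open>ys\<close> and then once more.
\<close>

lemma tree_fun_independent:
  assumes "\<forall>zs. distinct zs \<longrightarrow> length zs = Suc n \<longrightarrow> (\<Sum>T\<in>Tam n. c T * tree_fun T zs) = 0"
  shows "\<forall>T\<in>Tam n. c T = 0"
  using assms
proof (induction n arbitrary: c rule: less_induct)
  case (less n)
  show ?case
  proof
    fix T assume T: "T \<in> Tam n"
    show "c T = 0"
    proof (cases T)
      case Leaf
      with T have n: "n = 0" by (simp add: Tam_def)
      then have "Tam n = {Leaf}" by (auto simp: Tam_def)
      with less.prems[rule_format, of "[0]"] Leaf n show ?thesis by simp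
    next
      case (Node A u B)
      have n: "n = Suc (size A + size B)" using T Node by (simp add: Tam_def)
      have "\<forall>A\<in>Tam (size A). (\<Sum>B\<in>Tam (size B). c (pair A B) * tree_fun B ys) = 0"
        if ys: "distinct ys" "length ys = Suc (size B)" for ys
      proof (rule less.IH, simp add: n, intro allI impI)
        fix xs :: "real list" assume xs: "distinct xs" "length xs = Suc (size A)"
        have "(\<Sum>A\<in>Tam (length xs - 1). \<Sum>B\<in>Tam (length ys - 1). c (pair A B) * tree_fun A xs * tree_fun B ys) = 0"
          by (rule tree_fun_independent_gap[of n]) (use less.prems xs ys n in auto)
        then show "(\<Sum>A\<in>Tam (size A). (\<Sum>B\<in>Tam (size B). c (pair A B) * tree_fun B ys) * tree_fun A xs) = 0"
          using xs ys by (simp add: sum_distrib_left sum_distrib_right ac_simps)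
      qed
      then have "\<forall>B\<in>Tam (size B). c (pair A B) = 0"
        by (intro less.IH) (auto simp: n Tam_def)
      then show ?thesis by (simp add: Node Tam_def)
    qed
  qed
qed

section \<open>Signs\<close>

lemma divide_diff_swap: "p / (z - a) = - (p / (a - z))" for p :: real
  by (metis minus_diff_eq minus_divide_right)

definition signed_set_sum :: "nat \<Rightarrow> (real list \<Rightarrow> real) \<Rightarrow> bool" where
  "signed_set_sum n f \<longleftrightarrow> (\<exists>\<epsilon>\<in>{1, -1}. \<exists>X\<subseteq>Tam n.
     \<forall>zs. distinct zs \<longrightarrow> length zs = Suc n \<longrightarrow> f zs = \<epsilon> * (\<Sum>T\<in>X. tree_fun T zs))"

text \<open>
  The recursion of \<open>coxeter_fun\<close> involves the rotated function of the right subtree, so both are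
  treated together. Rotating the recursion turns the edge from \<open>a\<close> to the last point around, which costs a
  sign, and afterwards the function of \<open>A\<close> and the rotated function of \<open>B\<close> use adjacent
  runs of points, as they did before. The product of sets of trees then supplies the new set.
\<close>

lemma signed_set_sum_coxeter_fun:
  "signed_set_sum (size T) (coxeter_fun T) \<and> signed_set_sum (size T) (\<lambda>zs. coxeter_fun T (rotate1 zs))"
proof (induction T)
  case Leaf
  show ?case unfolding signed_set_sum_def
    by (auto intro!: exI[of _ "{Leaf}"] simp: Tam_def)
next
  case (Node A u B)
  from Node.IH(1) obtain \<epsilon> X where X: "\<epsilon> \<in> {1, -1}" "X \<subseteq> Tam (size A)"
    "\<And>zs. distinct zs \<Longrightarrow> length zs = Suc (size A) \<Longrightarrow> coxeter_fun A zs = \<epsilon> * (\<Sum>T\<in>X. tree_fun T zs)"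
    unfolding signed_set_sum_def by blast
  from Node.IH(2) obtain \<delta> Y where Y: "\<delta> \<in> {1, -1}" "Y \<subseteq> Tam (size B)"
    "\<And>zs. distinct zs \<Longrightarrow> length zs = Suc (size B) \<Longrightarrow> coxeter_fun B (rotate1 zs) = \<delta> * (\<Sum>T\<in>Y. tree_fun T zs)"
    unfolding signed_set_sum_def by blast
  have 1: "coxeter_fun (pair A B) zs = (\<epsilon> * \<delta>) * (\<Sum>T\<in>set_prod X ((\<lambda>S. pair S Leaf) ` Y). tree_fun T zs)"
    if "distinct zs" "length zs = Suc (size (pair A B))" for zs
  proof -
    from that(2) obtain us z where "zs = us @ [z]" "length us = Suc (size A + size B)"
      by (cases zs rule: rev_cases) auto
    moreover from this(2) obtain as a bs
      where "us = as @ a # bs" and len: "length as = size A" "length bs = size B"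
      by (rule length_eq_append_ConsE)
    ultimately have zs: "zs = as @ a # bs @ [z]" by simp
    show ?thesis
      using coxeter_fun_pair[of as A B a bs z] X(3)[of "as @ [a]"] Y(3)[of "a # bs"] len that(1)
        sum_set_prod_tree_fun[of X as "(\<lambda>S. pair S Leaf) ` Y" "bs @ [z]" a]
        X(2) pair_Leaf_image_Tam(1)[OF Y(2)] sum_tree_fun_pair_Leaf(1)[OF Y(2), of "a # bs" z]
      by (simp add: zs)
  qed
  have 2: "coxeter_fun (pair A B) (rotate1 zs) = - (\<epsilon> * \<delta>) * (\<Sum>T\<in>set_prod (pair Leaf ` X) Y. tree_fun T zs)"
    if "distinct zs" "length zs = Suc (size (pair A B))" for zs
  proof -
    from that(2) obtain z us where "zs = z # us" "length us = Suc (size A + size B)"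
      by (auto simp: length_Suc_conv)
    moreover from this(2) obtain as a bs
      where "us = as @ a # bs" and len: "length as = size A" "length bs = size B"
      by (rule length_eq_append_ConsE)
    ultimately have zs: "zs = z # as @ a # bs" by simp
    show ?thesis
      using coxeter_fun_pair[of as A B a bs z] X(3)[of "as @ [a]"] Y(3)[of "a # bs"] len that(1)
        sum_set_prod_tree_fun[of "pair Leaf ` X" "z # as" Y bs a]
        Y(2) pair_Leaf_image_Tam(2)[OF X(2)] sum_tree_fun_pair_Leaf(2)[OF X(2), of "as @ [a]" z]
      by (simp add: zs divide_diff_swap[of _ z a])
  qed
  have "signed_set_sum (size (pair A B)) (coxeter_fun (pair A B))"
    unfolding signed_set_sum_def
    using 1 X(1) Y(1) set_prod_subset_Tam[OF X(2) pair_Leaf_image_Tam(1)[OF Y(2)]]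
    by (intro bexI[of _ "\<epsilon> * \<delta>"] exI[of _ "set_prod X ((\<lambda>S. pair S Leaf) ` Y)"]) auto
  moreover have "signed_set_sum (size (pair A B)) (\<lambda>zs. coxeter_fun (pair A B) (rotate1 zs))"
    unfolding signed_set_sum_def
    using 2 X(1) Y(1) set_prod_subset_Tam[OF pair_Leaf_image_Tam(2)[OF X(2)] Y(2)]
    by (intro bexI[of _ "- (\<epsilon> * \<delta>)"] exI[of _ "set_prod (pair Leaf ` X) Y"]) auto
  ultimately show ?case by simp
qed

section \<open>Coxeter matrices of ranked posets\<close>

text \<open>
  This is the uniqueness half of Moebius inversion: look at an element of largest rank in the support of
  \<open>g\<close>.
\<close>

lemma above_sums_zero:
  fixes g :: "'b \<Rightarrow> 'c::ab_group_add" and rank :: "'b \<Rightarrow> nat"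
  assumes "finite J" "\<And>i. i \<in> J \<Longrightarrow> leq i i"
    and "\<And>i j. i \<in> J \<Longrightarrow> j \<in> J \<Longrightarrow> leq i j \<Longrightarrow> i = j \<or> rank i < rank j"
    and zero: "\<And>i. i \<in> J \<Longrightarrow> (\<Sum>j | j \<in> J \<and> leq i j. g j) = 0"
  shows "\<forall>i\<in>J. g i = 0"
proof (rule ccontr)
  assume "\<not> (\<forall>i\<in>J. g i = 0)"
  then have ne: "{i\<in>J. g i \<noteq> 0} \<noteq> {}" by blast
  from assms(1) have "finite {i\<in>J. g i \<noteq> 0}" by simp
  from Max_in[OF finite_imageI[OF this, of rank]] ne
  obtain i where i: "i \<in> J" "g i \<noteq> 0" "rank i = Max (rank ` {i\<in>J. g i \<noteq> 0})" by auto
  have "(\<Sum>j | j \<in> J \<and> leq i j. g j) = (\<Sum>j\<in>{i}. g j)"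
  proof (rule sum.mono_neutral_right)
    show "\<forall>j\<in>{j. j \<in> J \<and> leq i j} - {i}. g j = 0"
    proof (rule ccontr)
      assume "\<not> ?thesis"
      then obtain j where j: "j \<in> J" "leq i j" "j \<noteq> i" "g j \<noteq> 0" by blast
      from Max_ge[OF finite_imageI[OF \<open>finite {i\<in>J. g i \<noteq> 0}\<close>, of rank], of "rank j"] j i(3)
      have "rank j \<le> rank i" by auto
      with assms(3)[OF i(1) j(1,2)] j(3) show False by auto
    qed
  qed (use assms i in auto)
  with zero[OF i(1)] i(2) show False by simp
qed

lemma index_incidence_mat [simp]:
  "i < length xs \<Longrightarrow> j < length xs \<Longrightarrow>
     incidence_mat leq xs $$ (i, j) = (if leq (xs ! i) (xs ! j) then 1 else 0)"
  "dim_row (incidence_mat leq xs) = length xs" "dim_col (incidence_mat leq xs) = length xs"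
  by (simp_all add: incidence_mat_def)

lemma incidence_mat_carrier [simp]: "incidence_mat leq xs \<in> carrier_mat (length xs) (length xs)"
  by (simp add: incidence_mat_def)

text \<open>
  The rank makes the incidence matrix invertible for every order of the listing: it stands in for the
  linear extension along which the matrix would be unitriangular.
\<close>

locale ranked_listing =
  fixes leq :: "'a \<Rightarrow> 'a \<Rightarrow> bool" and rank :: "'a \<Rightarrow> nat" and xs :: "'a list"
  assumes distinct: "distinct xs"
    and refl: "leq x x"
    and rank: "leq x y \<Longrightarrow> x = y \<or> rank x < rank y"
begin

lemma above_index_sums_zero:
  fixes g :: "nat \<Rightarrow> 'c::ab_group_add"
  assumes "\<And>i. i < length xs \<Longrightarrow> (\<Sum>j | j < length xs \<and> leq (xs ! i) (xs ! j). g j) = 0"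
    and "i < length xs"
  shows "g i = 0"
proof -
  have "\<forall>i\<in>{..<length xs}. g i = 0"
  proof (rule above_sums_zero)
    fix i j assume "i \<in> {..<length xs}" "j \<in> {..<length xs}" "leq (xs ! i) (xs ! j)"
    with rank[of "xs ! i" "xs ! j"] distinct show "i = j \<or> rank (xs ! i) < rank (xs ! j)"
      by (simp add: nth_eq_iff_index_eq)
  qed (use assms(1) refl in auto)
  with assms(2) show ?thesis by simp
qed

lemma mat_inverse_incidence_mat:
  obtains J where "mat_inverse (incidence_mat leq xs) = Some J"
    "J \<in> carrier_mat (length xs) (length xs)" "incidence_mat leq xs * J = 1\<^sub>m (length xs)"
proof -
  let ?I = "incidence_mat leq xs" and ?n = "length xs"
  have "v = 0\<^sub>v ?n" if v: "v \<in> carrier_vec ?n" "?I *\<^sub>v v = 0\<^sub>v ?n" for v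
  proof -
    have "v $ i = 0" if "i < ?n" for i
    proof (rule above_index_sums_zero[OF _ that])
      fix i assume i: "i < ?n"
      from v(2) i have "(?I *\<^sub>v v) $ i = 0" by simp
      moreover have "(?I *\<^sub>v v) $ i = (\<Sum>j<?n. if leq (xs ! i) (xs ! j) then v $ j else 0)"
        using i v(1) by (auto simp: scalar_prod_def lessThan_atLeast0 intro!: sum.cong)
      ultimately show "(\<Sum>j | j < ?n \<and> leq (xs ! i) (xs ! j). v $ j) = 0"
        by (simp add: sum.If_cases lessThan_def Collect_conj_eq)
    qed
    with v(1) show ?thesis by (intro eq_vecI) auto
  qed
  then have "det ?I \<noteq> 0"
    using det_0_iff_vec_prod_zero[of ?I ?n] by auto
  then have "?I \<in> Units (ring_mat TYPE(rat) ?n ())"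
    by (intro det_non_zero_imp_unit) simp_all
  with mat_inverse(1)[of ?I ?n "()"] obtain J where "mat_inverse ?I = Some J"
    by (cases "mat_inverse ?I") auto
  with mat_inverse(2)[of ?I ?n J] that show thesis by simp
qed

lemma coxeter_mat_carrier [simp]: "coxeter_mat leq xs \<in> carrier_mat (length xs) (length xs)"
  by (rule mat_inverse_incidence_mat) (auto simp: coxeter_mat_def intro!: mult_carrier_mat)

lemma coxeter_mat_dim [simp]:
  "dim_row (coxeter_mat leq xs) = length xs" "dim_col (coxeter_mat leq xs) = length xs"
  by (rule carrier_matD[OF coxeter_mat_carrier])+

lemma coxeter_mat_incidence:
  "coxeter_mat leq xs * transpose_mat (incidence_mat leq xs) = - incidence_mat leq xs"
proof (rule mat_inverse_incidence_mat)
  let ?I = "incidence_mat leq xs" and ?n = "length xs"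
  fix J assume J: "mat_inverse ?I = Some J" "J \<in> carrier_mat ?n ?n" "?I * J = 1\<^sub>m ?n"
  have *: "transpose_mat J * transpose_mat ?I = 1\<^sub>m ?n"
    using transpose_mult[of ?I ?n ?n J ?n] J by simp
  have "coxeter_mat leq xs * transpose_mat ?I = - (?I * transpose_mat J) * transpose_mat ?I"
    by (simp add: coxeter_mat_def J)
  also have "\<dots> = - (?I * (transpose_mat J * transpose_mat ?I))"
    using J by (simp add: assoc_mult_mat[of _ ?n ?n _ ?n _ ?n])
  also have "\<dots> = - ?I" unfolding * by simp
  finally show "coxeter_mat leq xs * transpose_mat ?I = - ?I" .
qed

text \<open>
  The Coxeter matrix takes the indicator of each up-set to minus the indicator of the down-set of the
  same element, and the indicators of the up-sets form a basis. So the two functionals given by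
  \<open>\<phi>\<close> and \<open>\<psi>\<close> need only be compared on down-sets and up-sets.
\<close>

lemma coxeter_mat_transforms:
  fixes \<phi> \<psi> :: "nat \<Rightarrow> real"
  assumes sums: "\<And>i. i < length xs \<Longrightarrow> (\<Sum>j | j < length xs \<and> leq (xs ! j) (xs ! i). \<phi> j) =
      (\<Sum>j | j < length xs \<and> leq (xs ! i) (xs ! j). \<psi> j)"
    and j: "j < length xs"
  shows "(\<Sum>i<length xs. of_rat (coxeter_mat leq xs $$ (i, j)) * \<phi> i) = - \<psi> j"
proof -
  let ?I = "incidence_mat leq xs" and ?n = "length xs" and ?C = "coxeter_mat leq xs"
  let ?g = "\<lambda>j. (\<Sum>i<?n. of_rat (?C $$ (i, j)) * \<phi> i) + \<psi> j"
  have "?g j = 0"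
  proof (rule above_index_sums_zero[OF _ j])
    fix k assume k: "k < ?n"
    have C: "(\<Sum>j | j < ?n \<and> leq (xs ! k) (xs ! j). ?C $$ (i, j)) = - ?I $$ (i, k)" if "i < ?n" for i
    proof -
      have "(?C * transpose_mat ?I) $$ (i, k) = (\<Sum>j<?n. if leq (xs ! k) (xs ! j) then ?C $$ (i, j) else 0)"
        using k that
        by (auto simp: scalar_prod_def lessThan_atLeast0 intro!: sum.cong)
      with k that show ?thesis
        by (simp add: coxeter_mat_incidence sum.If_cases lessThan_def Collect_conj_eq)
    qed
    have "(\<Sum>j | j < ?n \<and> leq (xs ! k) (xs ! j). \<Sum>i<?n. of_rat (?C $$ (i, j)) * \<phi> i) =
        (\<Sum>i<?n. of_rat (\<Sum>j | j < ?n \<and> leq (xs ! k) (xs ! j). ?C $$ (i, j)) * \<phi> i)"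
      by (subst sum.swap) (simp add: of_rat_sum sum_distrib_right)
    also have "\<dots> = (\<Sum>i<?n. - (if leq (xs ! i) (xs ! k) then \<phi> i else 0))"
      by (intro sum.cong refl) (use k C in \<open>auto simp: of_rat_minus\<close>)
    also have "\<dots> = - (\<Sum>i | i < ?n \<and> leq (xs ! i) (xs ! k). \<phi> i)"
      by (simp add: sum_negf sum.If_cases lessThan_def Collect_conj_eq)
    finally show "(\<Sum>j | j < ?n \<and> leq (xs ! k) (xs ! j). ?g j) = 0"
      using sums[OF k] by (simp add: sum.distrib)
  qed
  then show ?thesis by simp
qed

end

section \<open>The Coxeter matrix of the Tamari lattice\<close>

lemma sum_nth_Tam:
  assumes "distinct xs" "set xs = Tam n" "\<And>T. P T \<Longrightarrow> T \<in> Tam n"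
  shows "(\<Sum>i | i < length xs \<and> P (xs ! i). f (xs ! i)) = (\<Sum>T | P T. f T)"
proof -
  have "(!) xs ` {i. i < length xs \<and> P (xs ! i)} = {T. P T}"
    using assms(2,3) by (force simp: in_set_conv_nth)
  with assms(1) have "bij_betw ((!) xs) {i. i < length xs \<and> P (xs ! i)} {T. P T}"
    by (auto simp: bij_betw_def inj_on_def nth_eq_iff_index_eq)
  then show ?thesis by (rule sum.reindex_bij_betw)
qed

theorem proposition8p5:
  fixes n :: nat and xs :: "pbtree list" and C :: "rat mat"
  assumes "distinct xs" and "set xs = Tam n"
    and "C = coxeter_mat tam_le xs"
  shows "C ^\<^sub>m (2 * n + 2) = 1\<^sub>m (length xs) \<and>
    (\<forall>i < length xs. \<forall>j < length xs. C $$ (i, j) \<in> {0, 1, -1}) \<and>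
    (\<forall>j < length xs. \<forall>i < length xs. \<forall>k < length xs.
       C $$ (i, j) \<noteq> 0 \<longrightarrow> C $$ (k, j) \<noteq> 0 \<longrightarrow> sgn (C $$ (i, j)) = sgn (C $$ (k, j)))"
proof -
  let ?N = "length xs"
  interpret ranked_listing tam_le left_weight xs
    by unfold_locales (use assms(1) in \<open>auto dest: tam_le_left_weight\<close>)
  have C [simp]: "C \<in> carrier_mat ?N ?N" using assms(3) by simp
  have nth: "size (xs ! i) = n" if "i < ?N" for i
    using that assms(2) nth_mem[OF that] by (auto simp: Tam_def)
  have below: "(\<Sum>j | j < ?N \<and> tam_le (xs ! j) (xs ! i). f (xs ! j)) = (\<Sum>T | tam_le T (xs ! i). f T)"
    and above: "(\<Sum>j | j < ?N \<and> tam_le (xs ! i) (xs ! j). f (xs ! j)) = (\<Sum>T | tam_le (xs ! i) T. f T)"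
    if "i < ?N" for i and f :: "pbtree \<Rightarrow> real"
    using nth[OF that]
    by (intro sum_nth_Tam[OF assms(1,2)]; auto simp: Tam_def dest: tam_le_size)+
  have independent: "a i = b i"
    if "\<And>zs. distinct zs \<Longrightarrow> length zs = Suc n \<Longrightarrow>
        (\<Sum>i<?N. a i * tree_fun (xs ! i) zs) = (\<Sum>i<?N. b i * tree_fun (xs ! i) zs)" "i < ?N" for a b i
  proof -
    let ?idx = "the_inv_into {..<?N} ((!) xs)"
    have bij: "bij_betw ((!) xs) {..<?N} (Tam n)"
      using bij_betw_nth[OF assms(1)] assms(2) by auto
    have idx: "?idx (xs ! i) = i" if "i < ?N" for i
      using bij that by (simp add: bij_betw_def the_inv_into_f_f)
    have "\<forall>T\<in>Tam n. a (?idx T) - b (?idx T) = 0"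
    proof (rule tree_fun_independent, intro allI impI)
      fix zs :: "real list" assume "distinct zs" "length zs = Suc n"
      from that(1)[OF this] have "(\<Sum>i<?N. (a i - b i) * tree_fun (xs ! i) zs) = 0"
        by (simp add: left_diff_distrib sum_subtractf)
      also have "(\<Sum>i<?N. (a i - b i) * tree_fun (xs ! i) zs) =
          (\<Sum>i<?N. (a (?idx (xs ! i)) - b (?idx (xs ! i))) * tree_fun (xs ! i) zs)"
        by (intro sum.cong) (simp_all add: idx)
      also have "\<dots> = (\<Sum>T\<in>Tam n. (a (?idx T) - b (?idx T)) * tree_fun T zs)"
        by (rule sum.reindex_bij_betw[OF bij])
      finally show "(\<Sum>T\<in>Tam n. (a (?idx T) - b (?idx T)) * tree_fun T zs) = 0" .
    qed
    moreover have "xs ! i \<in> Tam n" using that(2) assms(2) nth_mem by blast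
    ultimately show ?thesis using idx[OF that(2)] by fastforce
  qed
  have C_tree_fun: "(\<Sum>i<?N. of_rat (C $$ (i, j)) * tree_fun (xs ! i) zs) = - coxeter_fun (xs ! j) zs"
    if "j < ?N" "distinct zs" "length zs = Suc n" for j zs
    unfolding assms(3)
  proof (rule coxeter_mat_transforms[OF _ that(1)])
    fix i assume i: "i < ?N"
    show "(\<Sum>j | j < ?N \<and> tam_le (xs ! j) (xs ! i). tree_fun (xs ! j) zs) =
        (\<Sum>j | j < ?N \<and> tam_le (xs ! i) (xs ! j). coxeter_fun (xs ! j) zs)"
      using sum_coxeter_fun_above[of zs "xs ! i"] that nth[OF i]
        below[OF i, of "\<lambda>T. tree_fun T zs"] above[OF i, of "\<lambda>T. coxeter_fun T zs"]
      by simp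
  qed
  have C_coxeter_fun: "(\<Sum>i<?N. of_rat (C $$ (i, j)) * coxeter_fun (xs ! i) (rotate1 zs)) = - ((-1) ^ n * tree_fun (xs ! j) zs)"
    if "j < ?N" "distinct zs" "length zs = Suc n" for j zs
    unfolding assms(3)
  proof (rule coxeter_mat_transforms[OF _ that(1)])
    fix i assume i: "i < ?N"
    show "(\<Sum>j | j < ?N \<and> tam_le (xs ! j) (xs ! i). coxeter_fun (xs ! j) (rotate1 zs)) =
        (\<Sum>j | j < ?N \<and> tam_le (xs ! i) (xs ! j). (-1) ^ n * tree_fun (xs ! j) zs)"
      using sum_coxeter_fun_below_rotate1[of zs "xs ! i"] that nth[OF i] i
        below[OF i, of "\<lambda>T. coxeter_fun T (rotate1 zs)"] above[OF i, of "\<lambda>T. tree_fun T zs"]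
      by (simp flip: sum_distrib_left)
  qed
  have mult: "(\<Sum>i<?N. of_rat ((M * M') $$ (i, j)) * f i) =
      (\<Sum>k<?N. of_rat (M' $$ (k, j)) * (\<Sum>i<?N. of_rat (M $$ (i, k)) * f i))"
    if "M \<in> carrier_mat ?N ?N" "M' \<in> carrier_mat ?N ?N" "j < ?N" for M M' :: "rat mat" and f :: "nat \<Rightarrow> real" and j
  proof -
    have "(M * M') $$ (i, j) = (\<Sum>k<?N. M $$ (i, k) * M' $$ (k, j))" if "i < ?N" for i
      using that \<open>j < ?N\<close> \<open>M \<in> _\<close> \<open>M' \<in> _\<close> by (auto simp: scalar_prod_def lessThan_atLeast0 intro!: sum.cong)
    then have "(\<Sum>i<?N. of_rat ((M * M') $$ (i, j)) * f i) =
        (\<Sum>i<?N. \<Sum>k<?N. of_rat (M' $$ (k, j)) * (of_rat (M $$ (i, k)) * f i))"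
      by (simp add: of_rat_sum of_rat_mult sum_distrib_left sum_distrib_right ac_simps)
    also have "\<dots> = (\<Sum>k<?N. of_rat (M' $$ (k, j)) * (\<Sum>i<?N. of_rat (M $$ (i, k)) * f i))"
      by (subst sum.swap) (simp add: sum_distrib_left)
    finally show ?thesis .
  qed
  have one: "(\<Sum>i<?N. of_rat ((1\<^sub>m ?N :: rat mat) $$ (i, j)) * f i) = f j"
    if "j < ?N" for j and f :: "nat \<Rightarrow> real"
  proof -
    have "(\<Sum>i<?N. of_rat ((1\<^sub>m ?N :: rat mat) $$ (i, j)) * f i) = (\<Sum>i<?N. if i = j then f j else 0)"
      by (intro sum.cong) (use that in auto)
    with that show ?thesis by simp
  qed
  \<comment> \<open>the two matched families combine to the square of \<open>C\<close>, a signed rotation of the points\<close>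
  have C2: "(\<Sum>i<?N. of_rat ((C * C) $$ (i, j)) * tree_fun (xs ! i) (rotate1 zs)) = (-1) ^ n * tree_fun (xs ! j) zs"
    if "j < ?N" "distinct zs" "length zs = Suc n" for j zs
    using that C_tree_fun[of _ "rotate1 zs"] C_coxeter_fun[OF that] by (simp add: mult sum_negf)
  have pow: "(\<Sum>i<?N. of_rat ((C ^\<^sub>m (2 * m)) $$ (i, j)) * tree_fun (xs ! i) (rotate m zs)) =
      (-1) ^ (n * m) * tree_fun (xs ! j) zs"
    if "j < ?N" "distinct zs" "length zs = Suc n" for j zs m
    using that
  proof (induction m arbitrary: j zs)
    case 0
    have "C ^\<^sub>m (2 * 0) = 1\<^sub>m ?N" using carrier_matD(1)[OF C] by simp
    with one[OF 0(1), of "\<lambda>i. tree_fun (xs ! i) zs"] show ?case by simp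
  next
    case (Suc m)
    have M: "C ^\<^sub>m (2 * m) \<in> carrier_mat ?N ?N" by (rule pow_carrier_mat) simp
    have "C ^\<^sub>m (2 * Suc m) = C ^\<^sub>m (2 * m) * (C * C)"
      using M C by (simp add: assoc_mult_mat[of _ ?N ?N _ ?N _ ?N])
    moreover have "rotate (Suc m) zs = rotate m (rotate1 zs)"
      by (simp only: rotate_def funpow_Suc_right o_apply)
    ultimately have "(\<Sum>i<?N. of_rat ((C ^\<^sub>m (2 * Suc m)) $$ (i, j)) * tree_fun (xs ! i) (rotate (Suc m) zs)) =
        (\<Sum>k<?N. of_rat ((C * C) $$ (k, j)) * ((-1) ^ (n * m) * tree_fun (xs ! k) (rotate1 zs)))"
      using Suc M by (simp add: mult mult_carrier_mat[OF C C])
    also have "\<dots> = (-1) ^ (n * m) * (\<Sum>k<?N. of_rat ((C * C) $$ (k, j)) * tree_fun (xs ! k) (rotate1 zs))"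
      by (simp add: sum_distrib_left ac_simps)
    also have "\<dots> = (-1) ^ (n * Suc m) * tree_fun (xs ! j) zs"
      using C2[OF Suc.prems] by (simp add: power_add)
    finally show ?case .
  qed
  have periodic: "C ^\<^sub>m (2 * n + 2) = 1\<^sub>m ?N"
  proof (rule eq_matI)
    fix i j assume "i < dim_row (1\<^sub>m ?N :: rat mat)" "j < dim_col (1\<^sub>m ?N :: rat mat)"
    then have ij: "i < ?N" "j < ?N" by simp_all
    have "(of_rat ((C ^\<^sub>m (2 * Suc n)) $$ (i, j)) :: real) = of_rat ((1\<^sub>m ?N) $$ (i, j))"
    proof (rule independent[OF _ ij(1)])
      fix zs :: "real list" assume zs: "distinct zs" "length zs = Suc n"
      \<comment> \<open>the points have made a full turn, and \<open>n * Suc n\<close> is even\<close>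
      have "rotate (Suc n) zs = zs" using zs(2) by (intro rotate_id) simp
      moreover have "(-1 :: real) ^ (n * Suc n) = 1" by simp
      ultimately have "(\<Sum>i<?N. of_rat ((C ^\<^sub>m (2 * Suc n)) $$ (i, j)) * tree_fun (xs ! i) zs) = tree_fun (xs ! j) zs"
        using pow[OF ij(2) zs, of "Suc n"] by simp
      also have "\<dots> = (\<Sum>i<?N. of_rat ((1\<^sub>m ?N :: rat mat) $$ (i, j)) * tree_fun (xs ! i) zs)"
        by (rule one[OF ij(2), symmetric])
      finally show "(\<Sum>i<?N. of_rat ((C ^\<^sub>m (2 * Suc n)) $$ (i, j)) * tree_fun (xs ! i) zs) =
          (\<Sum>i<?N. of_rat ((1\<^sub>m ?N :: rat mat) $$ (i, j)) * tree_fun (xs ! i) zs)" .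
    qed
    then show "(C ^\<^sub>m (2 * n + 2)) $$ (i, j) = 1\<^sub>m ?N $$ (i, j)" by simp
  qed (use carrier_matD[OF C] in simp_all)
  \<comment> \<open>by independence, the entries of a column are the coefficients of \<open>- coxeter_fun\<close>\<close>
  have column: "\<exists>s\<in>{1, -1}. \<forall>i<?N. C $$ (i, j) \<in> {0, s}" if j: "j < ?N" for j
  proof -
    have "signed_set_sum n (coxeter_fun (xs ! j))"
      using signed_set_sum_coxeter_fun[of "xs ! j"] nth[OF j] by simp
    then obtain \<epsilon> :: real and X
      where X: "\<epsilon> \<in> {1, -1}" "X \<subseteq> Tam n"
        "\<And>zs. distinct zs \<Longrightarrow> length zs = Suc n \<Longrightarrow> coxeter_fun (xs ! j) zs = \<epsilon> * (\<Sum>T\<in>X. tree_fun T zs)"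
      unfolding signed_set_sum_def by blast
    have entry: "(of_rat (C $$ (i, j)) :: real) = (if xs ! i \<in> X then - \<epsilon> else 0)" if "i < ?N" for i
    proof (rule independent[OF _ that])
      fix zs :: "real list" assume zs: "distinct zs" "length zs = Suc n"
      have "(\<Sum>i<?N. (if xs ! i \<in> X then - \<epsilon> else 0) * tree_fun (xs ! i) zs) =
          (\<Sum>i<?N. if xs ! i \<in> X then - \<epsilon> * tree_fun (xs ! i) zs else 0)"
        by (intro sum.cong) auto
      also have "\<dots> = (\<Sum>i | i < ?N \<and> xs ! i \<in> X. - \<epsilon> * tree_fun (xs ! i) zs)"
        by (simp add: sum.If_cases lessThan_def Collect_conj_eq)
      also have "\<dots> = (\<Sum>T\<in>X. - \<epsilon> * tree_fun T zs)"
        using sum_nth_Tam[OF assms(1,2), of "\<lambda>T. T \<in> X" "\<lambda>T. - \<epsilon> * tree_fun T zs"] X(2) by auto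
      finally show "(\<Sum>i<?N. of_rat (C $$ (i, j)) * tree_fun (xs ! i) zs) =
          (\<Sum>i<?N. (if xs ! i \<in> X then - \<epsilon> else 0) * tree_fun (xs ! i) zs)"
        using C_tree_fun[OF j zs] X(3)[OF zs] by (simp add: sum_distrib_left sum_negf)
    qed
    from X(1) obtain s :: rat where s: "s \<in> {1, -1}" "- \<epsilon> = of_rat s" 
      by (auto intro: that[of 1] that[of "-1"])
    have "C $$ (i, j) \<in> {0, s}" if "i < ?N" for i
      using entry[OF that] s(2) by (auto split: if_splits)
    with s(1) show ?thesis by blast
  qed
  have "C $$ (i, j) \<in> {0, 1, -1}" if "i < ?N" "j < ?N" for i j
    using column[OF that(2)] that(1) by blast
  moreover have "sgn (C $$ (i, j)) = sgn (C $$ (k, j))"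
    if ij: "j < ?N" "i < ?N" "k < ?N" "C $$ (i, j) \<noteq> 0" "C $$ (k, j) \<noteq> 0" for i j k
  proof -
    from column[OF ij(1)] obtain s where "\<forall>i<?N. C $$ (i, j) \<in> {0, s}" by blast
    with ij have "C $$ (i, j) = s" "C $$ (k, j) = s" by auto
    then show ?thesis by simp
  qed
  ultimately show ?thesis using periodic by blast
qed

end
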